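(* Let $\Omega_n=\dfrac{\pi^{n/2}}{\Gamma\left(\frac n2+1\right)}$ for $n\in\mathbb{N}$. As $n\to\infty$, the following asymptotic series holds: \[ \frac{1}{n}\ln \Omega _{n}\sim -\frac{n+1}{2n}\ln \frac{n}{2}+\frac{1}{2}\ln\left( \pi e\right) -\frac{\ln 2\pi }{2n}-\sum_{j=1}^{\infty }\frac{2^{2j-2}B_{2j}}{j\left( 2j-1\right) n^{2j}}, \] where $B_{k}$ denote the Bernoulli numbers.
   Context: $\Omega_n$ is the volume of the unit ball in $\mathbb{R}^n$; $\Gamma$ is Euler's gamma function. The Bernoulli numbers $B_k$ are defined by $\frac{t}{e^t-1}=\sum_{k\ge0}B_k\frac{t^k}{k!}$ (so $B_2=\frac16$, $B_4=-\frac1{30}$). An asymptotic series $f(n)\sim g(n)+\sum_{j\ge1} a_j n^{-j}$ means that for every $N$, $f(n)-g(n)-\sum_{j=1}^{N}a_jn^{-j}=O(n^{-N-1})$ as $n\to\infty$. *)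

theory Defs
  imports "HOL-Analysis.Analysis" "HOL-Computational_Algebra.Formal_Power_Series"
    "HOL-Library.Landau_Symbols"
begin

definition bernoulli_num :: "nat \<Rightarrow> real" where
  "bernoulli_num k = fact k * fps_nth (fps_X / (fps_exp 1 - 1)) k"

text \<open>Volume of the unit ball in R^n.\<close>
definition Omega :: "nat \<Rightarrow> real" where
  "Omega n = pi powr (real n / 2) / Gamma (real n / 2 + 1)"

text \<open>Coefficient of n^(-j) in the asymptotic series (only even j contribute).\<close>
definition asym_coeff :: "nat \<Rightarrow> real" where
  "asym_coeff j = (if even j then - (2 ^ (j - 2) * bernoulli_num j)
                     / (real (j div 2) * (real j - 1)) else 0)"

end

theory Submission
  imports Defs "HOL-Real_Asymp.Real_Asymp"
begin

text \<open>
  Since \<open>ln \<Omega>\<^sub>n = (n/2) ln \<pi> - ln \<Gamma>(n/2 + 1)\<close>, the claim is Stirling's series at \<open>x = n/2\<close>. Let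
  \<open>R\<^sub>N(x)\<close> be the error of the series for \<open>ln \<Gamma>(x + 1)\<close> truncated before \<open>x\<^sup>-\<^sup>N\<close>. The difference
  \<open>R\<^sub>N(x + 1) - R\<^sub>N(x)\<close> is elementary and analytic in \<open>t = 1/x\<close>; the recurrence of the Bernoulli
  numbers says exactly that its Taylor coefficients up to \<open>t\<^sup>N\<close> vanish, so it is \<open>O(x\<^sup>-\<^sup>N\<^sup>-\<^sup>1)\<close>.
  Moreover \<open>R\<^sub>N(x + k) \<rightarrow> 0\<close> as \<open>k \<rightarrow> \<infinity>\<close>: the limit exists along the integers, it is the same along
  \<open>x + k\<close> by Gauss's product for \<open>\<Gamma>\<close>, and Wallis's product identifies it as \<open>0\<close>. Summing the
  differences over \<open>x, x + 1, \<dots>\<close> gives \<open>R\<^sub>N(x) = O(x\<^sup>-\<^sup>N)\<close>.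
\<close>

section \<open>Bernoulli numbers: recurrence, first values, odd indices\<close>

text \<open>Division of formal power series is exact only if the divisor divides the dividend; here
  both have subdegree 1.\<close>

lemma bernoulli_fps_mult:
  "(fps_X / (fps_exp 1 - 1)) * (fps_exp 1 - 1) = (fps_X :: real fps)"
proof -
  have nz: "fps_exp 1 - (1::real fps) \<noteq> 0"
  proof
    assume "fps_exp 1 - (1::real fps) = 0"
    from arg_cong[OF this, of "\<lambda>f. fps_nth f 1"] show False by simp
  qed
  have "subdegree (fps_exp 1 - (1::real fps)) = 1"
    by (rule subdegreeI) auto
  then have "(fps_exp 1 - 1) dvd (fps_X :: real fps)"
    using nz by (subst fps_dvd_iff) auto
  then show ?thesis by simp
qed

lemma bernoulli_num_sum:
  assumes "n \<ge> 2"
  shows "(\<Sum>j<n. real (n choose j) * bernoulli_num j) = 0"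
proof -
  let ?B = "fps_X / (fps_exp 1 - 1) :: real fps"
  have "0 = fps_nth (?B * (fps_exp 1 - 1)) n"
    using assms by (subst bernoulli_fps_mult) (simp add: fps_X_def)
  also have "\<dots> = (\<Sum>j=0..n. fps_nth ?B j * fps_nth (fps_exp 1 - 1) (n - j))"
    by (rule fps_mult_nth)
  also have "\<dots> = (\<Sum>j<n. fps_nth ?B j * fps_nth (fps_exp 1 - 1) (n - j))"
    by (rule sum.mono_neutral_right) auto
  also have "\<dots> = (\<Sum>j<n. real (n choose j) * bernoulli_num j / fact n)"
    by (rule sum.cong) (auto simp: bernoulli_num_def binomial_fact field_simps)
  finally show ?thesis
    by (simp flip: sum_divide_distrib)
qed

lemma bernoulli_num_0: "bernoulli_num 0 = 1"
  using bernoulli_num_sum[of 2] arg_cong[OF bernoulli_fps_mult, of "\<lambda>f. fps_nth f 1"]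
  by (simp add: bernoulli_num_def fps_mult_nth)

lemma bernoulli_num_1: "bernoulli_num 1 = - 1 / 2"
  using bernoulli_num_sum[of 2] by (simp add: bernoulli_num_0 numeral_2_eq_2)

text \<open>The series \<open>B(X) = X / (exp X - 1)\<close> satisfies \<open>B(-X) = B(X) + X\<close>.\<close>
lemma bernoulli_num_odd:
  assumes "odd n" "n > 1"
  shows "bernoulli_num n = 0"
proof -
  define B where "B = (fps_X / (fps_exp 1 - 1) :: real fps)"
  define C where "C = B oo (- fps_X)"
  have B: "B * (fps_exp 1 - 1) = fps_X"
    unfolding B_def by (rule bernoulli_fps_mult)
  have "C * (fps_exp (-1) - 1) = (B * (fps_exp 1 - 1)) oo (- fps_X)"
    unfolding C_def by (subst fps_compose_mult_distrib) (auto simp: fps_compose_sub_distrib)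
  also have "\<dots> = - fps_X"
    by (simp add: B)
  \<comment> \<open>The factor \<open>fps_exp 1\<close> turns \<open>fps_exp (-1) - 1\<close> into
    \<open>1 - fps_exp 1\<close>, so that \<open>C\<close> and \<open>B + fps_X\<close> can be
    compared after multiplication by one nonzero series.\<close>
  finally have "C * (fps_exp (-1) - 1) * fps_exp 1 = - fps_X * fps_exp 1" by simp
  moreover have "fps_exp (-1) * fps_exp (1::real) = 1"
    by (simp flip: fps_exp_add_mult)
  ultimately have "C * (fps_exp 1 - 1) = fps_X * fps_exp 1"
    by (simp add: algebra_simps)
  also have "\<dots> = (B + fps_X) * (fps_exp 1 - 1)"
    by (simp add: ring_distribs(2) B) (simp add: algebra_simps)
  finally have "C = B + fps_X"
    using B by force
  then have "fps_nth C n = fps_nth B n" using assms by (simp add: fps_X_def)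
  moreover have "fps_nth C n = - fps_nth B n"
    using assms by (simp add: C_def fps_compose_uminus')
  ultimately show ?thesis by (simp add: bernoulli_num_def B_def)
qed

section \<open>Coefficients of Stirling's series\<close>

text \<open>The coefficient belongs to the power \<open>x ^ (j - 1)\<close> in the denominator. Odd
  \<open>j\<close> are kept, with value 0, so that sums over all \<open>j\<close> match the
  Bernoulli recurrence.\<close>

definition stirling_coeff :: "nat \<Rightarrow> real" where
  "stirling_coeff j = bernoulli_num j / (real j * (real j - 1))"

text \<open>This is the Bernoulli recurrence at \<open>m + 1\<close>: absorbing twice turns
  \<open>(m - 1) choose (j - 2)\<close> into \<open>(m + 1) choose j\<close> and cancels
  \<open>j (j - 1)\<close>, the sign is harmless because odd Bernoulli numbers vanish for
  \<open>j > 1\<close>, and the terms \<open>j = 0, 1\<close> produce the right-hand side.\<close>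

lemma stirling_coeff_binomial_sum:
  assumes "m \<ge> 1"
  shows "(\<Sum>j=2..m. stirling_coeff j * (-1) ^ j * real ((m - 1) choose (j - 2)))
           = 1 / real (m + 1) - 1 / (2 * real m)"
proof -
  have scale: "b / d * s * c = a * b / e"
    if "d * a = e * c" "s * b = b" "d \<noteq> 0" "e \<noteq> 0" for a b c d e s :: real
  proof -
    have "b / d * s * c = (s * b) * (e * c) / (d * e)" using that(3,4) by simp
    also have "\<dots> = a * b / e" unfolding that(2) that(1)[symmetric] using that(3,4) by simp
    finally show ?thesis .
  qed
  have "stirling_coeff j * (-1) ^ j * real ((m - 1) choose (j - 2))
          = real ((m + 1) choose j) * bernoulli_num j / (real m * real (m + 1))"
    if j: "j \<in> {2..m}" for j
  proof -
    obtain i k where i: "j = i + 2" and k: "m = k + 1"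
      using j by (intro that[of "j - 2" "m - 1"]) auto
    have 1: "real (i + 2) * real ((k + 2) choose (i + 2)) = real (k + 2) * real ((k + 1) choose (i + 1))"
      using binomial_absorption[of "i + 1" "k + 2"] by (metis (no_types) Suc_eq_plus1 add_2_eq_Suc'
          diff_Suc_1 of_nat_mult)
    have 2: "real (i + 1) * real ((k + 1) choose (i + 1)) = real (k + 1) * real (k choose i)"
      using binomial_absorption[of i "k + 1"] by (metis (no_types) Suc_eq_plus1 diff_Suc_1 of_nat_mult)
    have "(real j * (real j - 1)) * real ((m + 1) choose j)
            = real (i + 1) * (real (i + 2) * real ((k + 2) choose (i + 2)))"
      by (simp add: i k)
    also have "\<dots> = real (k + 2) * (real (i + 1) * real ((k + 1) choose (i + 1)))"
      unfolding 1 by (simp only: mult_ac)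
    also have "\<dots> = (real m * real (m + 1)) * real ((m - 1) choose (j - 2))"
      unfolding 2 by (simp add: i k)
    finally have "(real j * (real j - 1)) * real ((m + 1) choose j)
                 = (real m * real (m + 1)) * real ((m - 1) choose (j - 2))" .
    moreover have "(-1) ^ j * bernoulli_num j = bernoulli_num j"
      using j bernoulli_num_odd[of j] by (cases "even j") auto
    moreover have "real j * (real j - 1) \<noteq> 0" "real m * real (m + 1) \<noteq> 0"
      using j by auto
    ultimately show ?thesis
      unfolding stirling_coeff_def by (rule scale)
  qed
  then have "(\<Sum>j=2..m. stirling_coeff j * (-1) ^ j * real ((m - 1) choose (j - 2)))
      = (\<Sum>j=2..m. real ((m + 1) choose j) * bernoulli_num j) / (real m * real (m + 1))"
    by (simp add: sum_divide_distrib)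
  also have "(\<Sum>j=2..m. real ((m + 1) choose j) * bernoulli_num j) = (real m - 1) / 2"
  proof -
    have "{..<m + 1} = {0, 1} \<union> {2..m}" using assms by auto
    then have "0 = (\<Sum>j\<in>{0,1} \<union> {2..m}. real ((m + 1) choose j) * bernoulli_num j)"
      using bernoulli_num_sum[of "m + 1"] assms by simp
    also have "\<dots> = 1 - real (m + 1) / 2 + (\<Sum>j=2..m. real ((m + 1) choose j) * bernoulli_num j)"
      using bernoulli_num_1 by (subst sum.union_disjoint) (auto simp: bernoulli_num_0)
    finally show ?thesis by (simp add: field_simps)
  qed
  finally show ?thesis using assms by (simp add: field_simps)
qed

section \<open>Power series of one step of the remainder\<close>

lemma has_fps_expansion_ln_real:
  "(\<lambda>x::real. ln (1 + x)) has_fps_expansion fps_ln 1"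
proof (rule has_fps_expansionI)
  have "eventually (\<lambda>x::real. x \<in> ball 0 1) (nhds 0)"
    by (intro eventually_nhds_in_open) auto
  then show "eventually (\<lambda>x::real. (\<lambda>n. fps_nth (fps_ln 1) n * x ^ n) sums ln (1 + x)) (nhds 0)"
  proof eventually_elim
    case (elim x)
    have "(\<lambda>n. - ((- x) ^ n) / real n) = (\<lambda>n. fps_nth (fps_ln 1) n * x ^ n)"
    proof
      \<comment> \<open>At \<open>n = 0\<close> division by zero gives 0, which agrees with the zero
        constant term of \<open>fps_ln 1\<close>.\<close>
      fix n show "- ((- x) ^ n) / real n = fps_nth (fps_ln 1) n * x ^ n"
        by (cases n) (auto simp: fps_ln_nth power_minus[of x])
    qed
    then show ?case using ln_series'[of x] elim by simp
  qed
qed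

text \<open>
  \<open>stirling_step N t\<close> is \<open>t (R\<^sub>N(x + 1) - R\<^sub>N(x))\<close> at \<open>x = 1/t\<close>, where the factor \<open>t\<close> makes it a
  power series in \<open>t\<close> without division.
\<close>
definition stirling_step :: "nat \<Rightarrow> real \<Rightarrow> real" where
  "stirling_step N t = t - (1 + t / 2) * ln (1 + t)
     - (\<Sum>j=2..N. stirling_coeff j * t ^ j * (inverse ((1 + t) ^ (j - 1)) - 1))"

definition stirling_step_fps :: "nat \<Rightarrow> real fps" where
  "stirling_step_fps N = fps_X - (1 + fps_const (1/2) * fps_X) * fps_ln 1
     - (\<Sum>j=2..N. fps_const (stirling_coeff j) * fps_X ^ j * (fps_binomial (- real (j - 1)) - 1))"

lemma stirling_step_has_fps_expansion:
  "stirling_step N has_fps_expansion stirling_step_fps N"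
proof -
  have "(\<lambda>t::real. inverse ((1 + t) ^ n)) has_fps_expansion fps_binomial (- real n)" for n
    unfolding fps_binomial_minus_of_nat
  proof (rule has_fps_expansion_inverse)
    have "(\<lambda>t::real. \<Prod>i<n. 1 + t) has_fps_expansion (\<Prod>i<n. 1 + fps_X)"
      by (intro fps_expansion_intros)
    then show "(\<lambda>t::real. (1 + t) ^ n) has_fps_expansion (1 + fps_X) ^ n" by simp
  qed (simp add: fps_nth_power_0)
  moreover have "(\<lambda>t::real. 1 + 1/2 * t) has_fps_expansion 1 + fps_const (1/2) * fps_X"
    by (intro fps_expansion_intros)
  ultimately show ?thesis
    unfolding stirling_step_def[abs_def] stirling_step_fps_def
    by (intro has_fps_expansion_diff has_fps_expansion_sum has_fps_expansion_mult
          has_fps_expansion_fps_X has_fps_expansion_fps_X_power has_fps_expansion_ln_real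
          has_fps_expansion_const has_fps_expansion_1) (simp_all only: mult_1 times_divide_eq_left)
qed

text \<open>For \<open>n = m + 1\<close> the coefficient of the sum is, up to sign, the left side of
  \<open>stirling_coeff_binomial_sum\<close>, and the logarithm supplies the right side. The bound
  on \<open>n\<close> gives \<open>m <= N\<close>, so no required \<open>j\<close> is cut off by the
  truncation.\<close>

lemma stirling_step_fps_nth:
  assumes "n < N + 2"
  shows "fps_nth (stirling_step_fps N) n = 0"
proof (cases "n \<ge> 2")
  case False
  then have n: "n = 0 \<or> n = 1" by auto
  have "fps_nth (\<Sum>j=2..N. fps_const (stirling_coeff j) * fps_X ^ j * (fps_binomial (- real (j - 1)) - 1)) n = 0"
    unfolding fps_sum_nth using n
    by (intro sum.neutral) (auto simp: mult.assoc fps_X_power_mult_nth)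
  then show ?thesis
    using n unfolding stirling_step_fps_def
    by (auto simp: ring_distribs mult.assoc fps_ln_nth)
next
  case True
  then obtain m where n: "n = Suc m" and m: "m \<ge> 1" by (cases n) auto
  have mN: "m \<le> N" using assms n by simp
  have "fps_nth (\<Sum>j=2..N. fps_const (stirling_coeff j) * fps_X ^ j * (fps_binomial (- real (j - 1)) - 1)) n
          = (\<Sum>j=2..N. if j \<le> m then (-1) ^ Suc m * (stirling_coeff j * (-1) ^ j * real ((m - 1) choose (j - 2))) else 0)"
    unfolding fps_sum_nth
  proof (rule sum.cong[OF refl])
    fix j assume j: "j \<in> {2..N}"
    have *: "(- real (j - 1) gchoose (Suc m - j)) = (-1) ^ (Suc m - j) * real ((m - 1) choose (j - 2))"
      if "j \<le> m"
    proof -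
      have "(- real (j - 1) gchoose (Suc m - j))
              = (-1) ^ (Suc m - j) * ((real (j - 1) + real (Suc m - j) - 1) gchoose (Suc m - j))"
        by (rule gbinomial_minus)
      also have "real (j - 1) + real (Suc m - j) - 1 = real (m - 1)"
        using that j m by (simp add: of_nat_diff)
      also have "real (m - 1) gchoose (Suc m - j) = real ((m - 1) choose (Suc m - j))"
        by (simp add: binomial_gbinomial)
      also have "(m - 1) choose (Suc m - j) = (m - 1) choose (j - 2)"
      proof -
        have eq: "Suc m - j = (m - 1) - (j - 2)" and le: "j - 2 \<le> m - 1" using that j by auto
        show ?thesis unfolding eq by (rule binomial_symmetric[OF le, symmetric])
      qed
      finally show ?thesis .
    qed
    have "(-1::real) ^ (Suc m - j) = (-1) ^ Suc m * (-1) ^ j" if "j \<le> m"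
      using that by (auto simp: minus_one_power_iff)
    then show "fps_nth (fps_const (stirling_coeff j) * fps_X ^ j * (fps_binomial (- real (j - 1)) - 1)) n
      = (if j \<le> m then (-1) ^ Suc m * (stirling_coeff j * (-1) ^ j * real ((m - 1) choose (j - 2))) else 0)"
      using * n by (auto simp: mult.assoc fps_X_power_mult_nth)
  qed
  also have "\<dots> = (\<Sum>j=2..m. (-1) ^ Suc m * (stirling_coeff j * (-1) ^ j * real ((m - 1) choose (j - 2))))"
    using mN by (intro sum.mono_neutral_cong_right) auto
  also have "\<dots> = (-1) ^ Suc m * (1 / real (m + 1) - 1 / (2 * real m))"
    unfolding sum_distrib_left[symmetric] stirling_coeff_binomial_sum[OF m] ..
  finally have "fps_nth (stirling_step_fps N) n
      = - fps_nth ((1 + fps_const (1/2) * fps_X) * fps_ln 1) n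
        - (-1) ^ Suc m * (1 / real (m + 1) - 1 / (2 * real m))"
    using n m unfolding stirling_step_fps_def by (simp add: fps_X_def)
  also have "fps_nth ((1 + fps_const (1/2) * fps_X) * fps_ln 1) n = (-1) ^ m / real (m + 1) - (-1) ^ m / (2 * real m)"
    using n m by (cases m) (simp_all add: ring_distribs mult.assoc fps_ln_nth)
  finally show ?thesis by (simp add: algebra_simps)
qed

text \<open>The series is divisible by the power \<open>N + 2\<close> of the variable, so the
  quotient extends continuously to 0 and is bounded nearby. The zero series is treated apart, since
  its \<open>subdegree\<close> is 0 by convention.\<close>

lemma stirling_step_bigo: "stirling_step N \<in> O[at 0](\<lambda>t. t ^ (N + 2))"
proof (cases "stirling_step_fps N = 0")
  case True
  then have "eventually (\<lambda>t. stirling_step N t = 0) (at 0)"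
    using stirling_step_has_fps_expansion[of N]
    by (auto simp: has_fps_expansion_def eventually_at_filter elim: eventually_mono)
  then show ?thesis
    by (subst landau_o.big.in_cong[where g = "\<lambda>_. 0"]) auto
next
  case False
  let ?G = "fps_shift (N + 2) (stirling_step_fps N)"
  let ?g = "\<lambda>t. if t = 0 then fps_nth (stirling_step_fps N) (N + 2) else stirling_step N t / t ^ (N + 2)"
  have "N + 2 \<le> subdegree (stirling_step_fps N)"
    using False stirling_step_fps_nth by (intro subdegree_geI) auto
  then have "?g has_fps_expansion ?G"
    by (intro has_fps_expansion_shift stirling_step_has_fps_expansion refl)
  from has_fps_expansion_imp_continuous[OF this, of UNIV]
  have "(?g \<longlongrightarrow> ?g 0) (at 0)" by (simp add: continuous_def)
  then have "((\<lambda>t. stirling_step N t / t ^ (N + 2)) \<longlongrightarrow> ?g 0) (at 0)"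
    by (rule Lim_transform_eventually) (auto simp: eventually_at_filter)
  then show ?thesis
    by (rule bigoI_tendsto) (auto simp: eventually_at_filter)
qed

section \<open>The remainder and its differences\<close>

text \<open>For \<open>N = 1\<close> the sum is empty and this is the error of the plain Stirling
  formula; the limit is computed in that case.\<close>

definition stirling_remainder :: "nat \<Rightarrow> real \<Rightarrow> real" where
  "stirling_remainder N x = ln_Gamma (x + 1)
     - ((x + 1/2) * ln x - x + ln (2 * pi) / 2 + (\<Sum>j=2..N. stirling_coeff j / x ^ (j - 1)))"

text \<open>The functional equation of \<open>Gamma\<close> replaces the difference of the
  \<open>ln_Gamma\<close> terms by \<open>ln (x + 1)\<close>.\<close>

lemma stirling_remainder_plus1:
  assumes x: "x > 0"
  shows "stirling_remainder N (x + 1) - stirling_remainder N x = x * stirling_step N (1 / x)"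
proof -
  have G: "ln_Gamma (x + 1 + 1) = ln_Gamma (x + 1) + ln (x + 1)"
  proof -
    have "Gamma (x + 1) \<noteq> 0" using x by (intro less_imp_neq[symmetric] Gamma_real_pos) auto
    moreover have "Gamma (x + 1 + 1) = (x + 1) * Gamma (x + 1)"
      using x by (intro Gamma_plus1) (auto elim!: nonpos_Ints_cases)
    ultimately show ?thesis
      using x by (simp add: ln_Gamma_real_pos ln_mult)
  qed
  have L: "ln (1 + 1 / x) = ln (x + 1) - ln x"
  proof -
    have "1 + 1 / x = (x + 1) / x" using x by (simp add: field_simps)
    then show ?thesis using x by (simp add: ln_div)
  qed
  have "x * (stirling_coeff j * (1 / x) ^ j * (inverse ((1 + 1 / x) ^ (j - 1)) - 1))
          = stirling_coeff j / (x + 1) ^ (j - 1) - stirling_coeff j / x ^ (j - 1)"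
    if j: "j \<in> {2..N}" for j
  proof -
    obtain i where i: "j = Suc i" using j by (cases j) auto
    have "1 + 1 / x = (x + 1) / x" using x by (simp add: field_simps)
    then show ?thesis
      using x by (simp add: i power_divide field_simps)
  qed
  then have S: "x * (\<Sum>j=2..N. stirling_coeff j * (1 / x) ^ j * (inverse ((1 + 1 / x) ^ (j - 1)) - 1))
      = (\<Sum>j=2..N. stirling_coeff j / (x + 1) ^ (j - 1)) - (\<Sum>j=2..N. stirling_coeff j / x ^ (j - 1))"
    by (simp add: sum_distrib_left flip: sum_subtractf)
  have "x * stirling_step N (1 / x) = 1 - (x + 1 / 2) * (ln (x + 1) - ln x)
      - x * (\<Sum>j=2..N. stirling_coeff j * (1 / x) ^ j * (inverse ((1 + 1 / x) ^ (j - 1)) - 1))"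
    unfolding stirling_step_def L using x by (simp add: field_simps)
  then show ?thesis
    unfolding S stirling_remainder_def G by (simp add: algebra_simps)
qed

lemma stirling_remainder_step_bound:
  obtains C x0 where "C > 0" "x0 \<ge> 2"
    "\<And>x. x \<ge> x0 \<Longrightarrow> \<bar>stirling_remainder N (x + 1) - stirling_remainder N x\<bar> \<le> C / x ^ (N + 1)"
proof -
  have "filterlim (\<lambda>x::real. 1 / x) (at 0) at_top"
    by real_asymp
  from landau_o.big.compose[OF stirling_step_bigo this, of N]
  obtain C where C: "C > 0"
    "eventually (\<lambda>x. norm (stirling_step N (1 / x)) \<le> C * norm ((1 / x) ^ (N + 2))) at_top"
    by (auto elim: landau_o.bigE)
  then obtain x1 where x1: "\<And>x. x \<ge> x1 \<Longrightarrow> \<bar>stirling_step N (1 / x)\<bar> \<le> C * \<bar>(1 / x) ^ (N + 2)\<bar>"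
    by (auto simp: eventually_at_top_linorder)
  show ?thesis
  \<comment> \<open>The threshold 2 later ensures \<open>1 / (x - 1) <= 2 / x\<close>.\<close>
  proof (rule that[of C "max 2 x1"])
    fix x :: real assume x: "x \<ge> max 2 x1"
    have "\<bar>stirling_remainder N (x + 1) - stirling_remainder N x\<bar> = x * \<bar>stirling_step N (1 / x)\<bar>"
      using x by (subst stirling_remainder_plus1) (auto simp: abs_mult)
    also have "\<dots> \<le> x * (C * \<bar>(1 / x) ^ (N + 2)\<bar>)"
      using x x1[of x] by (intro mult_left_mono) auto
    also have "\<dots> = C / x ^ (N + 1)"
      using x by (simp add: power_divide field_simps)
    finally show "\<bar>stirling_remainder N (x + 1) - stirling_remainder N x\<bar> \<le> C / x ^ (N + 1)" .
  qed (use C in auto)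
qed

text \<open>For \<open>N = 1\<close> the differences are dominated by a multiple of
  \<open>1 / n ^ 2\<close>, hence summable, and they telescope.\<close>

lemma stirling_remainder_convergent: "convergent (\<lambda>n. stirling_remainder 1 (real n))"
proof -
  let ?d = "\<lambda>n. stirling_remainder 1 (real (Suc n)) - stirling_remainder 1 (real n)"
  obtain C x0 where C: "C > 0" "x0 \<ge> 2"
    "\<And>x. x \<ge> x0 \<Longrightarrow> \<bar>stirling_remainder 1 (x + 1) - stirling_remainder 1 x\<bar> \<le> C / x ^ (1 + 1)"
    using stirling_remainder_step_bound[of 1] by blast
  have "eventually (\<lambda>n. norm (?d n) \<le> C * inverse (real n ^ 2)) sequentially"
    using eventually_ge_at_top[of "nat \<lceil>x0\<rceil>"]
  proof eventually_elim
    case (elim n)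
    then show ?case using C(3)[of "real n"] by (simp add: field_simps power2_eq_square)
  qed
  moreover have "summable (\<lambda>n. C * inverse (real n ^ 2))"
    by (intro summable_mult inverse_power_summable) auto
  ultimately have "summable ?d"
    by (rule summable_comparison_test_ev)
  then have "convergent (\<lambda>n. (\<Sum>i<n. ?d i) + stirling_remainder 1 0)"
    unfolding summable_iff_convergent by (intro convergent_add convergent_const)
  then show ?thesis
    by (subst (asm) sum_lessThan_telescope) simp
qed

section \<open>Limit of the remainder: Gauss's and Wallis's products\<close>

text \<open>This is the logarithm of Gauss's product, with the Pochhammer symbol written as
  \<open>Gamma (x + n) / Gamma x\<close>.\<close>

lemma ln_Gamma_shift_asymptotics:
  fixes x :: real
  assumes "x > 0"
  shows "(\<lambda>n. ln_Gamma (x + real n) - ln_Gamma (real n) - x * ln (real n)) \<longlonglongrightarrow> 0"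
proof -
  have pos: "Gamma x > 0" using assms by (rule Gamma_real_pos)
  have "(\<lambda>n. ln (Gamma_series' x n)) \<longlonglongrightarrow> ln (Gamma x)"
    using pos by (intro tendsto_ln Gamma_series'_LIMSEQ) auto
  then have "(\<lambda>n. ln (Gamma x) - ln (Gamma_series' x n)) \<longlonglongrightarrow> ln (Gamma x) - ln (Gamma x)"
    by (intro tendsto_diff tendsto_const)
  then have lim: "(\<lambda>n. ln (Gamma x) - ln (Gamma_series' x n)) \<longlonglongrightarrow> 0" by simp
  have ev: "eventually (\<lambda>n. ln (Gamma x) - ln (Gamma_series' x n) = 
         ln_Gamma (x + real n) - ln_Gamma (real n) - x * ln (real n)) sequentially"
    using eventually_gt_at_top[of 0]
  proof eventually_elim
    case (elim n)
    have nz: "Gamma x \<noteq> 0" "Gamma (x + real n) \<noteq> 0" "Gamma (real n) \<noteq> 0"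
      using assms elim by (auto intro!: less_imp_neq[symmetric] Gamma_real_pos)
    have fct: "fact (n - 1) = Gamma (real n)"
      using Gamma_fact[of "n - 1", where 'a = real] elim by (simp add: of_nat_diff)
    have "Gamma_series' x n = Gamma (real n) * exp (x * ln (real n)) / (Gamma (x + real n) / Gamma x)"
      unfolding Gamma_series'_def fct using assms
      by (subst pochhammer_Gamma) (auto elim!: nonpos_Ints_cases)
    then show ?case
      using nz assms elim by (simp add: ln_mult ln_div ln_Gamma_real_pos)
  qed
  show ?thesis
    using lim ev by (rule Lim_transform_eventually)
qed

lemma stirling_remainder_shift:
  assumes "x > 0"
  shows "(\<lambda>n. stirling_remainder 1 (x + real n) - stirling_remainder 1 (real n)) \<longlonglongrightarrow> 0"
proof -
  \<comment> \<open>The remainder contains \<open>ln_Gamma\<close> at its argument plus 1, so the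
    shifts by \<open>x + 1\<close> and by 1 are both compared with \<open>ln_Gamma (real n)\<close>
    and subtracted.\<close>
  have "(\<lambda>n. (ln_Gamma ((x + 1) + real n) - ln_Gamma (real n) - (x + 1) * ln (real n))
          - (ln_Gamma (1 + real n) - ln_Gamma (real n) - 1 * ln (real n))) \<longlonglongrightarrow> 0 - 0"
    using assms by (intro tendsto_diff ln_Gamma_shift_asymptotics) auto
  moreover have "(\<lambda>n. (real n + 1/2) * ln (real n) + x * ln (real n) + x
                        - (x + real n + 1/2) * ln (x + real n)) \<longlonglongrightarrow> 0"
    by real_asymp
  ultimately have "(\<lambda>n. (ln_Gamma ((x + 1) + real n) - ln_Gamma (real n) - (x + 1) * ln (real n))
          - (ln_Gamma (1 + real n) - ln_Gamma (real n) - 1 * ln (real n))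
          + ((real n + 1/2) * ln (real n) + x * ln (real n) + x
               - (x + real n + 1/2) * ln (x + real n))) \<longlonglongrightarrow> 0 - 0 + 0"
    by (rule tendsto_add)
  then show ?thesis
    by (simp add: stirling_remainder_def algebra_simps)
qed

lemma wallis_product_fact:
  "(\<Prod>k=1..n. (4 * real k ^ 2) / (4 * real k ^ 2 - 1))
     = 16 ^ n * fact n ^ 4 / (fact (2 * n) ^ 2 * (2 * real n + 1))"
proof (induction n)
  case (Suc n)
  have "(\<Prod>k=1..Suc n. (4 * real k ^ 2) / (4 * real k ^ 2 - 1))
      = 16 ^ n * fact n ^ 4 / (fact (2 * n) ^ 2 * (2 * real n + 1))
        * (4 * (real n + 1) ^ 2 / (4 * real (Suc n) ^ 2 - 1))"
    using Suc.IH by (simp add: add_ac)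
  moreover have "4 * real (Suc n) ^ 2 - 1 = (2 * real n + 1) * (2 * real n + 3)"
    by (simp add: algebra_simps power2_eq_square)
  moreover have "fact (2 * Suc n) = 2 * (real n + 1) * (2 * real n + 1) * fact (2 * n)"
    by (simp add: algebra_simps)
  moreover have "fact (Suc n) = (real n + 1) * fact n" by simp
  moreover have "16 ^ n * a ^ 4 / (b ^ 2 * c) * (4 * m ^ 2 / (c * d))
      = 16 ^ Suc n * (m * a) ^ 4 / ((2 * m * c * b) ^ 2 * d)"
    if "m > 0" "c > 0" "d > 0" "b > 0" for a b c d m :: real
    using that by (simp add: field_simps power2_eq_square power4_eq_xxxx)
  note this[of "real n + 1" "2 * real n + 1" "2 * real n + 3" "fact (2 * n)" "fact n"]
  moreover have "2 * real (Suc n) + 1 = 2 * real n + 3" by simp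
  ultimately show ?case by (simp only:) auto
qed simp

text \<open>If \<open>c\<close> is the limit, \<open>4 R(n) - 2 R(2 n)\<close> tends to
  \<open>2 c\<close>. The same combination of log-factorials occurs in the logarithm of Wallis's
  product, which makes the limit 0.\<close>

lemma stirling_remainder_LIMSEQ: "(\<lambda>n. stirling_remainder 1 (real n)) \<longlonglongrightarrow> 0"
proof -
  let ?R = "stirling_remainder 1"
  obtain c where c: "(\<lambda>n. ?R (real n)) \<longlonglongrightarrow> c"
    using stirling_remainder_convergent by (auto simp: convergent_def)
  have "filterlim (\<lambda>n::nat. 2 * n) at_top sequentially"
    by real_asymp
  from filterlim_compose[OF c this] have c2: "(\<lambda>n. ?R (real (2 * n))) \<longlonglongrightarrow> c" .
  have "(\<lambda>n. 4 * ?R (real n) - 2 * ?R (real (2 * n))) \<longlonglongrightarrow> 4 * c - 2 * c"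
    by (intro tendsto_intros c c2)
  moreover have "(\<lambda>n. 4 * ?R (real n) - 2 * ?R (real (2 * n))) \<longlonglongrightarrow> 0"
  proof -
    let ?W = "\<lambda>n. \<Prod>k=1..n. (4 * real k ^ 2) / (4 * real k ^ 2 - 1)"
    \<comment> \<open>\<open>?e\<close> is exactly what separates \<open>ln (?W n)\<close> from
      \<open>4 R(n) - 2 R(2 n)\<close>; it tends to \<open>- ln (pi / 2)\<close>.\<close>
    let ?e = "\<lambda>n. - ln (pi / 2) + (ln (2 * real n + 1) - ln (2 * real n))"
    have "(\<lambda>n. ln (?W n) + ?e n) \<longlonglongrightarrow> ln (pi / 2) + (- ln (pi / 2) + 0)"
      by (intro tendsto_add tendsto_ln wallis tendsto_const) (simp, real_asymp)
    then have lim: "(\<lambda>n. ln (?W n) + ?e n) \<longlonglongrightarrow> 0" by simp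
    have ev: "eventually (\<lambda>n. ln (?W n) + ?e n = 4 * ?R (real n) - 2 * ?R (real (2 * n))) sequentially"
      using eventually_gt_at_top[of 0]
    proof eventually_elim
      case (elim n)
      have fct: "ln_Gamma (real m + 1) = ln (fact m)" for m
        using Gamma_fact[of m, where 'a = real] by (simp add: ln_Gamma_real_pos add_ac)
      have "ln (?W n) = real n * ln 16 + 4 * ln (fact n) - 2 * ln (fact (2 * n)) - ln (2 * real n + 1)"
        unfolding wallis_product_fact
        by (subst ln_div; simp add: ln_mult ln_realpow)
      moreover have "ln (16::real) = 4 * ln 2" "ln (4::real) = 2 * ln 2"
        using ln_realpow[of 2 4] ln_realpow[of 2 2] by simp_all
      moreover have "ln (2 * real n) = ln 2 + ln (real n)" using elim by (simp add: ln_mult)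
      ultimately show ?case
        using elim fct[of n] fct[of "2 * n"]
        by (simp add: stirling_remainder_def ln_mult ln_div field_simps)
    qed
    show ?thesis using lim ev by (rule Lim_transform_eventually)
  qed
  ultimately have "4 * c - 2 * c = 0" by (rule LIMSEQ_unique)
  then show ?thesis using c by simp
qed

text \<open>Passing from \<open>N = 1\<close> to general \<open>N\<close> only adds correction terms
  that tend to 0.\<close>

lemma stirling_remainder_shift_LIMSEQ:
  assumes "x > 0"
  shows "(\<lambda>n. stirling_remainder N (x + real n)) \<longlonglongrightarrow> 0"
proof -
  have "(\<lambda>n. stirling_remainder 1 (x + real n) - stirling_remainder 1 (real n)
          + stirling_remainder 1 (real n)) \<longlonglongrightarrow> 0 + 0"
    using assms by (intro tendsto_add stirling_remainder_shift stirling_remainder_LIMSEQ)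
  moreover have "(\<lambda>n. \<Sum>j=2..N. stirling_coeff j / (x + real n) ^ (j - 1)) \<longlonglongrightarrow> (\<Sum>j=2..N. 0)"
  proof (rule tendsto_sum)
    fix j assume "j \<in> {2..N}"
    then have "j - 1 > 0" by auto
    moreover have "filterlim (\<lambda>n. x + real n) at_top sequentially" by real_asymp
    ultimately have "filterlim (\<lambda>n. (x + real n) ^ (j - 1)) at_top sequentially"
      by (intro filterlim_pow_at_top) auto
    then show "(\<lambda>n. stirling_coeff j / (x + real n) ^ (j - 1)) \<longlonglongrightarrow> 0"
      by (intro tendsto_divide_0[OF tendsto_const] filterlim_at_top_imp_at_infinity)
  qed
  ultimately have "(\<lambda>n. stirling_remainder 1 (x + real n) - stirling_remainder 1 (real n)
          + stirling_remainder 1 (real n)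
          - (\<Sum>j=2..N. stirling_coeff j / (x + real n) ^ (j - 1))) \<longlonglongrightarrow> 0 + 0 - (\<Sum>j=2..N. 0)"
    by (rule tendsto_diff)
  then show ?thesis
    by (simp add: stirling_remainder_def algebra_simps)
qed

section \<open>Summing the differences\<close>

text \<open>For \<open>y >= x\<close>, \<open>N - 1\<close> of the factors \<open>y\<close> are
  replaced by \<open>x\<close>, and the remaining \<open>1 / y ^ 2\<close> is at most
  \<open>1 / (y (y - 1)) = 1 / (y - 1) - 1 / y\<close>, which telescopes.\<close>

lemma stirling_remainder_telescope:
  fixes x C :: real
  assumes "N \<ge> 1" "C \<ge> 0" "x \<ge> 2"
    and step: "\<And>y. y \<ge> x \<Longrightarrow> \<bar>stirling_remainder N (y + 1) - stirling_remainder N y\<bar> \<le> C / y ^ (N + 1)"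
  shows "\<bar>stirling_remainder N (x + real k) - stirling_remainder N x\<bar>
           \<le> C / x ^ (N - 1) * (1 / (x - 1) - 1 / (x + real k - 1))"
proof (induction k)
  case (Suc k)
  define y where "y = x + real k"
  have y: "y \<ge> x" "y \<ge> 2" using assms by (auto simp: y_def)
  have "C / y ^ (N + 1) = C / (y ^ (N - 1) * y ^ 2)"
    using assms(1) by (simp flip: power_add)
  also have "\<dots> \<le> C / (x ^ (N - 1) * (y * (y - 1)))"
  proof (rule divide_left_mono)
    show "x ^ (N - 1) * (y * (y - 1)) \<le> y ^ (N - 1) * y ^ 2"
      using y assms by (intro mult_mono power_mono) (auto simp: power2_eq_square)
  qed (use y assms in auto)
  also have "\<dots> = C / x ^ (N - 1) * (1 / (y - 1) - 1 / y)"
    using y by (simp add: field_simps)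
  finally have "\<bar>stirling_remainder N (y + 1) - stirling_remainder N x\<bar>
      \<le> C / x ^ (N - 1) * (1 / (x - 1) - 1 / (y - 1)) + C / x ^ (N - 1) * (1 / (y - 1) - 1 / y)"
    using step[OF y(1)] Suc.IH unfolding y_def[symmetric] by linarith
  also have "\<dots> = C / x ^ (N - 1) * (1 / (x - 1) - 1 / (y + 1 - 1))"
    by (simp add: right_diff_distrib)
  finally show ?case
    by (simp add: y_def add_ac)
qed simp

text \<open>The telescoped bound is uniform in \<open>k\<close>, so it survives \<open>k\<close>
  tending to infinity, where the remainder at \<open>x + k\<close> disappears.\<close>

theorem stirling_remainder_bigo:
  assumes "N \<ge> 1"
  shows "stirling_remainder N \<in> O[at_top](\<lambda>x. 1 / x ^ N)"
proof -
  obtain C x0 where C: "C > 0" "x0 \<ge> 2"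
    "\<And>x. x \<ge> x0 \<Longrightarrow> \<bar>stirling_remainder N (x + 1) - stirling_remainder N x\<bar> \<le> C / x ^ (N + 1)"
    using stirling_remainder_step_bound[of N] by blast
  have bound: "\<bar>stirling_remainder N x\<bar> \<le> 2 * C * \<bar>1 / x ^ N\<bar>" if x: "x \<ge> x0" for x
  proof -
    have "(\<lambda>k. \<bar>stirling_remainder N (x + real k) - stirling_remainder N x\<bar>)
            \<longlonglongrightarrow> \<bar>0 - stirling_remainder N x\<bar>"
      using x C by (intro tendsto_intros stirling_remainder_shift_LIMSEQ) auto
    moreover have "\<bar>stirling_remainder N (x + real k) - stirling_remainder N x\<bar>
        \<le> C / x ^ (N - 1) * (1 / (x - 1))" for k
    proof -
      have "\<bar>stirling_remainder N (x + real k) - stirling_remainder N x\<bar>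
          \<le> C / x ^ (N - 1) * (1 / (x - 1) - 1 / (x + real k - 1))"
        using assms x C by (intro stirling_remainder_telescope) auto
      also have "\<dots> \<le> C / x ^ (N - 1) * (1 / (x - 1))"
        using x C by (intro mult_left_mono) auto
      finally show ?thesis .
    qed
    ultimately have "\<bar>0 - stirling_remainder N x\<bar> \<le> C / x ^ (N - 1) * (1 / (x - 1))"
      by (intro LIMSEQ_le_const2) auto
    also have "\<dots> \<le> C / x ^ (N - 1) * (2 / x)"
      using x C by (intro mult_left_mono) (auto simp: field_simps)
    also have "\<dots> = 2 * C * \<bar>1 / x ^ N\<bar>"
      using assms x C by (cases N) (auto simp: field_simps)
    finally show ?thesis by simp
  qed
  show ?thesis
    using bound by (intro bigoI[of _ "2 * C"] eventually_at_top_linorderI[of x0]) simp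
qed

section \<open>Translation to the volume of the unit ball\<close>

text \<open>The power of 2 is the one produced by \<open>(n / 2) ^ (j - 1)\<close> in the
  denominator; writing \<open>j div 2\<close> for \<open>j / 2\<close> accounts for the exponent
  \<open>j - 2\<close> in \<open>asym_coeff\<close>.\<close>

lemma asym_coeff_conv_stirling_coeff:
  assumes "j \<ge> 2"
  shows "asym_coeff j = - (2 ^ (j - 1)) * stirling_coeff j"
proof (cases "even j")
  case True
  then obtain i where i: "j = 2 * i" by auto
  then obtain k where k: "i = Suc k" using assms by (cases i) auto
  have "2 ^ (2 * k) * b / ((real k + 1) * (2 * real k + 1))
      = 2 * 2 ^ (2 * k) * b / ((2 * real k + 2) * (2 * real k + 1))" for b :: real
    by (simp add: divide_simps)
  then show ?thesis
    by (simp add: i k asym_coeff_def stirling_coeff_def add_ac)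
next
  case False
  then show ?thesis
    using assms bernoulli_num_odd[of j] by (simp add: asym_coeff_def stirling_coeff_def)
qed

lemma asym_sum_conv_stirling_sum:
  assumes "x > 0"
  shows "(\<Sum>j=1..N. asym_coeff j / x ^ j) = - (\<Sum>j=2..N. stirling_coeff j / (x / 2) ^ (j - 1)) / x"
proof -
  have "(\<Sum>j=1..N. asym_coeff j / x ^ j) = (\<Sum>j=2..N. asym_coeff j / x ^ j)"
    \<comment> \<open>The term \<open>j = 1\<close> is 0 because 1 is odd.\<close>
    by (rule sum.mono_neutral_right) (auto simp: asym_coeff_def not_le less_2_cases_iff)
  also have "\<dots> = (\<Sum>j=2..N. - (stirling_coeff j / (x / 2) ^ (j - 1) / x))"
  proof (rule sum.cong[OF refl])
    fix j assume j: "j \<in> {2..N}"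
    then obtain i where "j = Suc i" by (cases j) auto
    then show "asym_coeff j / x ^ j = - (stirling_coeff j / (x / 2) ^ (j - 1) / x)"
      using j assms by (simp add: asym_coeff_conv_stirling_coeff power_divide mult_ac)
  qed
  finally show ?thesis by (simp add: sum_negf sum_divide_distrib)
qed

lemma ln_Omega:
  "ln (Omega n) = real n / 2 * ln pi - ln_Gamma (real n / 2 + 1)"
proof -
  have "Gamma (real n / 2 + 1) \<noteq> 0" by (intro less_imp_neq[symmetric] Gamma_real_pos) auto
  then show ?thesis
    unfolding Omega_def by (subst ln_div) (auto simp: ln_Gamma_real_pos ln_powr)
qed

text \<open>An exact identity at \<open>x = n / 2\<close>; the sign is negative because
  \<open>Gamma\<close> stands in the denominator of \<open>Omega\<close>.\<close>

lemma ln_Omega_expansion: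
  assumes "n > 0"
  shows "ln (Omega n) / real n
            - ( - (real n + 1) / (2 * real n) * ln (real n / 2) + ln (pi * exp 1) / 2
                - ln (2 * pi) / (2 * real n))
            - (\<Sum>j=1..N. asym_coeff j / real n ^ j)
         = - stirling_remainder N (real n / 2) / real n"
proof -
  define S where "S = (\<Sum>j=2..N. stirling_coeff j / (real n / 2) ^ (j - 1))"
  have S: "(\<Sum>j=1..N. asym_coeff j / real n ^ j) = - S / real n"
    using asym_sum_conv_stirling_sum[of "real n" N] assms by (simp add: S_def)
  have "ln (pi * exp 1) = ln pi + 1" by (simp add: ln_mult)
  then show ?thesis
    unfolding S stirling_remainder_def S_def[symmetric] ln_Omega
    using assms by (simp add: field_simps)
qed

lemma ln_Omega_bigo:
  assumes "N \<ge> 1"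
  shows "(\<lambda>n::nat. ln (Omega n) / real n
            - ( - (real n + 1) / (2 * real n) * ln (real n / 2) + ln (pi * exp 1) / 2
                - ln (2 * pi) / (2 * real n))
            - (\<Sum>j=1..N. asym_coeff j / real n ^ j))
         \<in> O(\<lambda>n. 1 / real n ^ (N + 1))"
proof -
  have "filterlim (\<lambda>n. real n / 2) at_top sequentially" by real_asymp
  from landau_o.big.compose[OF stirling_remainder_bigo[OF assms] this]
  have "(\<lambda>n. stirling_remainder N (real n / 2)) \<in> O(\<lambda>n. 1 / (real n / 2) ^ N)" .
  also have "(\<lambda>n. 1 / (real n / 2) ^ N) = (\<lambda>n. 2 ^ N * (1 / real n ^ N))"
    by (simp add: power_divide)
  also have "O(\<dots>) = O(\<lambda>n. 1 / real n ^ N)"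
    by (subst landau_o.big.cmult) auto
  \<comment> \<open>The factor \<open>1 / n\<close> in front of the logarithm raises the order from
    \<open>N\<close> to \<open>N + 1\<close>.\<close>
  finally have "(\<lambda>n. stirling_remainder N (real n / 2) * (- (1 / real n)))
      \<in> O(\<lambda>n. 1 / real n ^ N * (1 / real n))"
    by (intro landau_o.big.mult) auto
  then have *: "(\<lambda>n. - stirling_remainder N (real n / 2) / real n) \<in> O(\<lambda>n. 1 / real n ^ (N + 1))"
    by (simp add: mult_ac)
  have "eventually (\<lambda>n. ln (Omega n) / real n
            - ( - (real n + 1) / (2 * real n) * ln (real n / 2) + ln (pi * exp 1) / 2
                - ln (2 * pi) / (2 * real n))
            - (\<Sum>j=1..N. asym_coeff j / real n ^ j)
         = - stirling_remainder N (real n / 2) / real n) sequentially"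
    using eventually_gt_at_top[of 0] by eventually_elim (rule ln_Omega_expansion)
  from landau_o.big.in_cong[OF this] * show ?thesis by blast
qed

theorem theorem1:
  fixes N :: nat
  shows "(\<lambda>n::nat. ln (Omega n) / real n
            - ( - (real n + 1) / (2 * real n) * ln (real n / 2) + ln (pi * exp 1) / 2
                - ln (2 * pi) / (2 * real n))
            - (\<Sum>j=1..N. asym_coeff j / real n ^ j))
         \<in> O(\<lambda>n. 1 / real n ^ (N + 1))"
proof (cases "N = 0")
  case True
  \<comment> \<open>The coefficient of \<open>1/n\<close> vanishes, so the case \<open>N = 1\<close> is stronger; the telescoping bound needs \<open>N \<ge> 1\<close>.\<close>
  have "(\<lambda>n::nat. 1 / real n ^ (1 + 1)) \<in> O(\<lambda>n. 1 / real n ^ (0 + 1))"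
    by real_asymp
  from landau_o.big_trans[OF ln_Omega_bigo[OF order.refl] this] show ?thesis
    unfolding True by (simp add: asym_coeff_def)
next
  case False
  then show ?thesis by (intro ln_Omega_bigo) auto
qed

end
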